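(* Let $\vartheta$ be a primitive compatible random substitution on a finite alphabet $\mathcal{A}$ that is locally recognisable. If the RS-subshift $X_\vartheta$ is topologically mixing, then $\gcd\{|\vartheta^n(a)| : a\in\mathcal{A}\}=1$ for all $n\ge 1$.
   Context: Words and random substitutions. $\mathcal{A}=\{a_1,\dots,a_d\}$ is a finite alphabet, $\mathcal{A}^+$ the set of non-empty finite words over $\mathcal{A}$, $|w|$ the length of $w$, $|w|_a$ the number of occurrences of the letter $a$ in $w$; a subword is a contiguous factor $w_{[i,j]}=w_i\cdots w_j$. A random substitution $\vartheta$ assigns to each $a\in\mathcal{A}$ a non-empty finite set $\vartheta(a)\subset\mathcal{A}^+$. It extends to words by $\vartheta(v_1\cdots v_m)=\{w_1\cdots w_m : w_i\in\vartheta(v_i)\}$ and to sets of words by $\vartheta(B)=\bigcup_{w\in B}\vartheta(w)$, so the powers $\vartheta^k$ are defined. A word is $\vartheta$-legal if it is a subword of some element of $\vartheta^k(a)$ for some $k\ge 1$, $a\in\mathcal{A}$; $\mathcal{L}_\vartheta$ is the set of $\vartheta$-legal words. $X_\vartheta\subset\mathcal{A}^{\mathbb{Z}}$ is the set of bi-infinite sequences all of whose finite subwords are $\vartheta$-legal (the RS-subshift), with the shift action $\sigma$. Subshifts are by definition non-empty. $\vartheta$ is compatible if, for each $a\in\mathcal{A}$, all words in $\vartheta(a)$ have the same number of occurrences of each letter. Then the substitution matrix $M_\vartheta$ has $(i,j)$ entry equal to the common number of $a_i$'s in the words of $\vartheta(a_j)$, and $|\vartheta^n(a)|$ denotes the common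 length of the words in $\vartheta^n(a)$. $\vartheta$ is primitive if some power of $M_\vartheta$ has all entries positive. Topological mixing. A subshift $X$ with language $\mathcal{L}(X)$ (the set of finite subwords of elements of $X$) is topologically mixing if for all $u,v\in\mathcal{L}(X)$ there is $N$ such that for every $n\ge N$ there is a word $w$ of length $n$ with $uwv\in\mathcal{L}(X)$. Recognisability. An inflation word decomposition of a legal word $u$ is a pair $([u_1,\dots,u_\ell],v)$ where $u_i\in\mathcal{A}^+$, $u_1\cdots u_\ell=u$, $v=v_1\cdots v_\ell$ is $\vartheta$-legal, $u_i\in\vartheta(v_i)$ for $2\le i\le \ell-1$, $u_1$ is a suffix of an element of $\vartheta(v_1)$ and $u_\ell$ is a prefix of an element of $\vartheta(v_\ell)$ (if $\ell=1$, $u_1$ is a subword of an element of $\vartheta(v_1)$). For $1\le i\le j\le |u|$, such a decomposition induces the decomposition $([\hat u_{k(i)},u_{k(i)+1},\dots,u_{k(j)-1},\hat u_{k(j)}],v_{[k(i),k(j)]})$ of $u_{[i,j]}$, where $k(i),k(j)$ are the indices of the pieces containing positions $i$ and $j$ of $u$ (i.e. $|u_1\cdots u_{k(i)-1}|<i\le|u_1\cdots u_{k(i)}|$ and likewise for $j$), and $\hat u_{k(i)}$, $\hat u_{k(j)}$ are the suffix of $u_{k(i)}$ and prefix of $u_{k(j)}$ for which the concatenation equals $u_{[i,j]}$ (if $k(i)=k(j)$, the induced decomposition is $([u_{[i,j]}],v_{k(i)})$). A legal word $u$ is recognisable if there is a natural number $N$ such that for each legal word $w=u^{(l)}uu^{(r)}$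 with $|u^{(l)}|=|u^{(r)}|=N$, all inflation word decompositions of $w$ induce the same decomposition of this occurrence of $u$; the least such $N$ is the radius of recognisability of $u$. $\vartheta$ is locally recognisable if there is $N$ such that every $\vartheta$-legal word is recognisable with radius at most $N$. *)

theory Defs
  imports "HOL-Analysis.Finite_Cartesian_Product" "HOL-Library.Sublist" "HOL-Library.Multiset"
begin

text \<open>
  The alphabet is a finite type; words are lists, indexed from position 0.
\<close>

definition random_substitution :: "('a::finite \<Rightarrow> 'a list set) \<Rightarrow> bool" where
  "random_substitution \<theta> \<longleftrightarrow> (\<forall>a. \<theta> a \<noteq> {} \<and> finite (\<theta> a) \<and> [] \<notin> \<theta> a)"

definition subst_word :: "('a \<Rightarrow> 'a list set) \<Rightarrow> 'a list \<Rightarrow> 'a list set" where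
  "subst_word \<theta> v = {concat ws | ws. list_all2 (\<lambda>w a. w \<in> \<theta> a) ws v}"

definition subst_set :: "('a \<Rightarrow> 'a list set) \<Rightarrow> 'a list set \<Rightarrow> 'a list set" where
  "subst_set \<theta> B = (\<Union>w\<in>B. subst_word \<theta> w)"

definition subst_power :: "('a \<Rightarrow> 'a list set) \<Rightarrow> nat \<Rightarrow> 'a \<Rightarrow> 'a list set" where
  "subst_power \<theta> k a = (subst_set \<theta> ^^ k) {[a]}"

text \<open>Only non-empty words count as legal.\<close>

definition legal :: "('a \<Rightarrow> 'a list set) \<Rightarrow> 'a list \<Rightarrow> bool" where
  "legal \<theta> u \<longleftrightarrow> u \<noteq> [] \<and> (\<exists>k\<ge>1. \<exists>a. \<exists>w\<in>subst_power \<theta> k a. sublist u w)"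

definition language :: "(int \<Rightarrow> 'a) set \<Rightarrow> 'a list set" where
  "language X = {map x [i..j] | x i j. x \<in> X \<and> i \<le> j}"

definition RS_subshift :: "('a \<Rightarrow> 'a list set) \<Rightarrow> (int \<Rightarrow> 'a) set" where
  "RS_subshift \<theta> = {x. \<forall>i j. i \<le> j \<longrightarrow> legal \<theta> (map x [i..j])}"

definition compatible :: "('a \<Rightarrow> 'a list set) \<Rightarrow> bool" where
  "compatible \<theta> \<longleftrightarrow> (\<forall>a. \<forall>u\<in>\<theta> a. \<forall>v\<in>\<theta> a. \<forall>b. count_list u b = count_list v b)"

definition subst_matrix :: "('a::finite \<Rightarrow> 'a list set) \<Rightarrow> nat ^ 'a ^ 'a" where
  "subst_matrix \<theta> = (\<chi> i j. THE m. \<forall>w\<in>\<theta> j. count_list w i = m)"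

text \<open>The operation \<open>^\<close> on vectors of vectors is entrywise, so matrix powers are iterated \<open>**\<close>.\<close>

definition matrix_power :: "nat ^ 'a ^ 'a \<Rightarrow> nat \<Rightarrow> nat ^ 'a ^ ('a::finite)" where
  "matrix_power M k = (((**) M) ^^ k) (mat 1)"

definition primitive :: "('a::finite \<Rightarrow> 'a list set) \<Rightarrow> bool" where
  "primitive \<theta> \<longleftrightarrow> (\<exists>k\<ge>1. \<forall>i j. matrix_power (subst_matrix \<theta>) k $ i $ j > 0)"

definition inflation_length :: "('a \<Rightarrow> 'a list set) \<Rightarrow> nat \<Rightarrow> 'a \<Rightarrow> nat" where
  "inflation_length \<theta> n a = (THE m. \<forall>w\<in>subst_power \<theta> n a. length w = m)"

text \<open>Subshifts are non-empty by convention, hence the first conjunct.\<close>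

definition topologically_mixing :: "(int \<Rightarrow> 'a) set \<Rightarrow> bool" where
  "topologically_mixing X \<longleftrightarrow> X \<noteq> {} \<and>
     (\<forall>u\<in>language X. \<forall>v\<in>language X.
        \<exists>N. \<forall>n\<ge>N. \<exists>w. length w = n \<and> u @ w @ v \<in> language X)"

definition inflation_word_decomposition ::
    "('a \<Rightarrow> 'a list set) \<Rightarrow> 'a list \<Rightarrow> 'a list list \<times> 'a list \<Rightarrow> bool" where
  "inflation_word_decomposition \<theta> u d \<longleftrightarrow>
     (case d of (us, v) \<Rightarrow>
        [] \<notin> set us \<and> concat us = u \<and> length us = length v \<and> legal \<theta> v \<and>
        (if length us = 1 then \<exists>w\<in>\<theta> (hd v). sublist (hd us) w
         else (\<exists>w\<in>\<theta> (hd v). suffix (hd us) w) \<and>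
              (\<exists>w\<in>\<theta> (last v). prefix (last us) w) \<and>
              (\<forall>i. 0 < i \<and> i < length us - 1 \<longrightarrow> us ! i \<in> \<theta> (v ! i))))"

text \<open>Index of the piece of \<open>us\<close> that contains position \<open>p\<close> of \<open>concat us\<close>.\<close>

definition piece_index :: "'a list list \<Rightarrow> nat \<Rightarrow> nat" where
  "piece_index us p = (THE k. k < length us \<and>
     length (concat (take k us)) \<le> p \<and> p < length (concat (take (Suc k) us)))"

text \<open>
  The decomposition induced on positions \<open>p, \<dots>, q\<close> (both inclusive) of \<open>concat us\<close>.
\<close>

definition induced_decomposition ::
    "'a list list \<times> 'a list \<Rightarrow> nat \<Rightarrow> nat \<Rightarrow> 'a list list \<times> 'a list" where
  "induced_decomposition d p q =
     (case d of (us, v) \<Rightarrow>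
        let k = piece_index us p; l = piece_index us q in
        if k = l then ([take (Suc q - p) (drop p (concat us))], [v ! k])
        else ([drop (p - length (concat (take k us))) (us ! k)]
                @ take (l - Suc k) (drop (Suc k) us)
                @ [take (Suc q - length (concat (take l us))) (us ! l)],
              take (Suc l - k) (drop k v)))"

definition recognisable_at :: "('a \<Rightarrow> 'a list set) \<Rightarrow> 'a list \<Rightarrow> nat \<Rightarrow> bool" where
  "recognisable_at \<theta> u N \<longleftrightarrow>
     (\<forall>l r. length l = N \<and> length r = N \<and> legal \<theta> (l @ u @ r) \<longrightarrow>
        (\<forall>d d'. inflation_word_decomposition \<theta> (l @ u @ r) d \<and>
                inflation_word_decomposition \<theta> (l @ u @ r) d' \<longrightarrow>
           induced_decomposition d N (N + length u - 1) =
           induced_decomposition d' N (N + length u - 1)))"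

definition recognisable :: "('a \<Rightarrow> 'a list set) \<Rightarrow> 'a list \<Rightarrow> bool" where
  "recognisable \<theta> u \<longleftrightarrow> legal \<theta> u \<and> (\<exists>N. recognisable_at \<theta> u N)"

definition recognisability_radius :: "('a \<Rightarrow> 'a list set) \<Rightarrow> 'a list \<Rightarrow> nat" where
  "recognisability_radius \<theta> u = (LEAST N. recognisable_at \<theta> u N)"

definition locally_recognisable :: "('a \<Rightarrow> 'a list set) \<Rightarrow> bool" where
  "locally_recognisable \<theta> \<longleftrightarrow>
     (\<exists>N. \<forall>u. legal \<theta> u \<longrightarrow> recognisable \<theta> u \<and> recognisability_radius \<theta> u \<le> N)"

text \<open>For compatible \<open>\<theta>\<close> the definite descriptions above are well defined.\<close>

lemma subst_matrix_nth:
  assumes "compatible \<theta>" "w \<in> \<theta> j"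
  shows "subst_matrix \<theta> $ i $ j = count_list w i"
proof -
  have "\<forall>w'\<in>\<theta> j. count_list w' i = count_list w i"
    using assms unfolding compatible_def by blast
  then have "(THE m. \<forall>w\<in>\<theta> j. count_list w i = m) = count_list w i"
    using assms(2) by - (rule the_equality, metis+)
  then show ?thesis by (simp add: subst_matrix_def)
qed

lemma count_list_subst_word:
  assumes "compatible \<theta>" "w \<in> subst_word \<theta> v"
  shows "count_list w i = sum_list (map (\<lambda>a. subst_matrix \<theta> $ i $ a) v)"
proof -
  obtain ws where ws: "w = concat ws" "list_all2 (\<lambda>w a. w \<in> \<theta> a) ws v"
    using assms(2) unfolding subst_word_def by blast
  from ws(2) have "count_list (concat ws) i = sum_list (map (\<lambda>a. subst_matrix \<theta> $ i $ a) v)"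
  proof induction
    case Nil
    show ?case by simp
  next
    case (Cons w ws a v)
    then show ?case
      using subst_matrix_nth[of \<theta> w a i] assms(1) by simp
  qed
  with ws(1) show ?thesis by simp
qed

lemma mset_subst_power_unique:
  fixes \<theta> :: "'a::finite \<Rightarrow> 'a list set"
  assumes "compatible \<theta>" "w \<in> subst_power \<theta> n a" "w' \<in> subst_power \<theta> n a"
  shows "mset w = mset w'"
  using assms(2,3)
proof (induction n arbitrary: w w')
  case 0
  then show ?case by (simp add: subst_power_def)
next
  case (Suc n)
  obtain v v' where v: "v \<in> subst_power \<theta> n a" "w \<in> subst_word \<theta> v"
      "v' \<in> subst_power \<theta> n a" "w' \<in> subst_word \<theta> v'"
    using Suc.prems unfolding subst_power_def by (auto simp: subst_set_def)
  have eq: "mset v = mset v'" using Suc.IH[OF v(1,3)] .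
  have "count_list w i = count_list w' i" for i
  proof -
    let ?f = "\<lambda>a. subst_matrix \<theta> $ i $ a"
    have *: "sum_list (map ?f x) = sum_mset (image_mset ?f (mset x))" for x
      by (simp only: mset_map[symmetric] sum_mset_sum_list)
    show ?thesis
      unfolding count_list_subst_word[OF assms(1) v(2)]
        count_list_subst_word[OF assms(1) v(4)] * eq ..
  qed
  then show ?case by (intro multiset_eqI) (simp add: count_mset)
qed

lemma inflation_length_eq:
  fixes \<theta> :: "'a::finite \<Rightarrow> 'a list set"
  assumes "compatible \<theta>" "w \<in> subst_power \<theta> n a"
  shows "inflation_length \<theta> n a = length w"
proof -
  have "\<forall>w'\<in>subst_power \<theta> n a. length w' = length w"
    using mset_eq_length[OF mset_subst_power_unique[OF assms(1) _ assms(2)]] by blast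
  then show ?thesis
    unfolding inflation_length_def using assms(2) by - (rule the_equality, metis+)
qed

end

theory Submission
  imports Defs
begin

text \<open>
  Why the theorem holds. Fix a level \<open>n\<close> and let \<open>g\<close> be the gcd of the lengths of the level-\<open>n\<close>
  inflation words. If a word \<open>W\<close> starts and ends with the same long legal word, recognisability
  makes the two occurrences be cut into inflation words at the same relative places, so the
  displacement between them is a sum of lengths of inflation words, hence a multiple of \<open>g\<close>.
  Topological mixing provides displacements that differ by one, so \<open>g = 1\<close>.

  Recognisability is assumed for \<open>\<theta>\<close> only, not for its powers, so the argument descends one level
  at a time. Choose \<open>f a \<in> \<theta> a\<close> for each letter, and measure a word by the length of its
  image under \<open>m\<close> applications of \<open>f\<close> (\<open>iterated_length f m\<close>). Suppose \<open>g \<noteq> 1\<close>. The claim is: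
  for every \<open>m\<close>, each word \<open>U\<close> of the language of the subshift has a legal word \<open>y @ U\<close> that
  also begins with \<open>U\<close>, such that \<open>g\<close> does not divide \<open>iterated_length f m y\<close>.
  For \<open>m = 0\<close> this is mixing. For the step (\<open>desubstitute_return_word\<close>), apply the claim for \<open>m\<close>
  to an image of \<open>U\<close> with enough context, and desubstitute the resulting legal word: by
  recognisability, both occurrences of the image of \<open>U\<close> come from occurrences of \<open>U\<close>, and by
  compatibility the inflation words between them have, at level \<open>m\<close>, the same measure as the
  letters they come from have at level \<open>m + 1\<close>. At \<open>m = n\<close> the claim is absurd, because \<open>g\<close>
  divides the measure of every letter.

  The image of \<open>U\<close> with context has to lie in the language again; this holds because applying
  \<open>f\<close> to a bi-infinite sequence of the subshift gives another one (\<open>image_of_subshift_point\<close>).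
  Primitivity makes every letter legal, which ensures that every legal word can be desubstituted
  (\<open>legal_imp_tiling\<close>).
\<close>

section \<open>Cutting a word split into labelled pieces\<close>

abbreviation pieces_word :: "('b \<times> 'a list) list \<Rightarrow> 'a list" where
  "pieces_word ds \<equiv> concat (map snd ds)"

text \<open>
  A decomposition is handled as one list of pairs (label, piece). Restricting it to a range of
  positions is then a composition of two recursive cutting operations, which obey the same laws
  as \<open>drop\<close> and \<open>take\<close>; the indices of the pieces no longer appear.
\<close>

fun drop_letters :: "nat \<Rightarrow> ('b \<times> 'a list) list \<Rightarrow> ('b \<times> 'a list) list" where
  "drop_letters n [] = []"
| "drop_letters n ((a, u) # ds) =
     (if n < length u then (a, drop n u) # ds else drop_letters (n - length u) ds)"

fun take_letters :: "nat \<Rightarrow> ('b \<times> 'a list) list \<Rightarrow> ('b \<times> 'a list) list" where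
  "take_letters n [] = []"
| "take_letters n ((a, u) # ds) =
     (if n = 0 then [] else if n \<le> length u then [(a, take n u)]
      else (a, u) # take_letters (n - length u) ds)"

lemma drop_letters_drop_letters:
  "drop_letters n (drop_letters m ds) = drop_letters (m + n) ds"
  by (induction m ds rule: drop_letters.induct) (auto simp: add.commute)

lemma take_letters_take_letters:
  "n \<le> m \<Longrightarrow> take_letters n (take_letters m ds) = take_letters n ds"
  by (induction m ds arbitrary: n rule: take_letters.induct) (auto simp: min_def)

lemma drop_letters_take_letters:
  "n < m \<Longrightarrow> drop_letters n (take_letters m ds) = take_letters (m - n) (drop_letters n ds)"
proof (induction m ds arbitrary: n rule: take_letters.induct)
  case (2 m a u ds)
  show ?case
  proof (cases "n < length u")
    case True
    then show ?thesis using 2 by (auto simp: drop_take)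
  next
    case False
    then have "n - length u < m - length u" "m - length u - (n - length u) = m - n"
      using 2(2) by auto
    then show ?thesis using 2 False by auto
  qed
qed simp

lemma pieces_word_drop_letters: "pieces_word (drop_letters n ds) = drop n (pieces_word ds)"
  by (induction n ds rule: drop_letters.induct) auto

lemma pieces_word_take_letters: "pieces_word (take_letters n ds) = take n (pieces_word ds)"
  by (induction n ds rule: take_letters.induct) auto

lemma drop_letters_append:
  assumes "\<forall>(a, u) \<in> set ds'. u \<noteq> []"
  shows "drop_letters (length (pieces_word ds)) (ds @ ds') = ds'"
proof (induction ds)
  case Nil
  then show ?case using assms by (cases ds') auto
qed auto

lemma take_letters_append:
  assumes "\<forall>(a, u) \<in> set ds. u \<noteq> []"
  shows "take_letters (length (pieces_word ds)) (ds @ ds') = ds"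
  using assms
proof (induction ds)
  case Nil
  then show ?case by (cases ds') auto
next
  case (Cons d ds)
  then show ?case by (cases d; cases ds) (auto simp: Suc_le_eq)
qed

lemma drop_letters_split:
  assumes "n < length (pieces_word ds)"
  obtains ds1 a u ds2 m where "ds = ds1 @ (a, u) # ds2" "n = length (pieces_word ds1) + m"
    "m < length u" "drop_letters n ds = (a, drop m u) # ds2"
  using assms
proof (induction n ds arbitrary: thesis rule: drop_letters.induct)
  case (2 n a u ds)
  show ?case
  proof (cases "n < length u")
    case True
    then show ?thesis using 2(2)[of "[]" a u ds n] by simp
  next
    case False
    then have "n - length u < length (pieces_word ds)" using 2(3) by auto
    then obtain ds1 b w ds2 m where *: "ds = ds1 @ (b, w) # ds2"
        "n - length u = length (pieces_word ds1) + m" "m < length w"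
        "drop_letters (n - length u) ds = (b, drop m w) # ds2"
      using 2(1)[OF False] by blast
    then show ?thesis
      using False by (intro 2(2)[of "(a, u) # ds1" b w ds2 m]) auto
  qed
qed simp

lemma take_letters_split:
  assumes "0 < n" "n \<le> length (pieces_word ds)"
  obtains ds1 a u ds2 m where "ds = ds1 @ (a, u) # ds2"
    "0 < m" "m \<le> length u" "take_letters n ds = ds1 @ [(a, take m u)]"
  using assms
proof (induction n ds arbitrary: thesis rule: take_letters.induct)
  case (2 n a u ds)
  show ?case
  proof (cases "n \<le> length u")
    case True
    then show ?thesis using 2(2)[of "[]" a u ds n] 2(3) by simp
  next
    case False
    then have "0 < n - length u" "n - length u \<le> length (pieces_word ds)" using 2(4) by auto
    then obtain ds1 b w ds2 m where *: "ds = ds1 @ (b, w) # ds2"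
        "0 < m" "m \<le> length w"
        "take_letters (n - length u) ds = ds1 @ [(b, take m w)]"
      using 2(1)[OF _ False] 2(3) by blast
    then show ?thesis
      using False 2(3) by (intro 2(2)[of "(a, u) # ds1" b w ds2 m]) auto
  qed
qed simp

lemma piece_index_exists:
  assumes "p < length (concat us)"
  shows "\<exists>k. k < length us \<and>
     length (concat (take k us)) \<le> p \<and> p < length (concat (take (Suc k) us))"
  using assms
proof (induction us arbitrary: p)
  case (Cons u us)
  show ?case
  proof (cases "p < length u")
    case True
    then show ?thesis by (intro exI[of _ 0]) auto
  next
    case False
    then have "p - length u < length (concat us)" using Cons.prems by auto
    from Cons.IH[OF this] obtain k where "k < length us"
     "length (concat (take k us)) \<le> p - length u"
     "p - length u < length (concat (take (Suc k) us))" by blast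
    then show ?thesis using False by (intro exI[of _ "Suc k"]) auto
  qed
qed simp

lemma length_concat_take_mono: "i \<le> j \<Longrightarrow> length (concat (take i us)) \<le> length (concat (take j us))"
proof -
  assume "i \<le> j"
  then have "take j us = take i us @ take (j - i) (drop i us)"
    by (metis le_add_diff_inverse take_add)
  then show ?thesis by simp
qed

lemma piece_index_eqI:
  assumes "k < length us" "length (concat (take k us)) \<le> p" "p < length (concat (take (Suc k) us))"
  shows "piece_index us p = k"
  unfolding piece_index_def
proof (rule the_equality)
  fix k' assume *: "k' < length us \<and> length (concat (take k' us)) \<le> p
    \<and> p < length (concat (take (Suc k') us))"
  show "k' = k"
  proof (rule ccontr)
    assume "k' \<noteq> k"
    then consider "Suc k' \<le> k" | "Suc k \<le> k'" by linarith
    then show False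
      using length_concat_take_mono[of "Suc k'" k us] length_concat_take_mono[of "Suc k" k' us]
        * assms by cases linarith+
  qed
qed (use assms in blast)

lemma piece_index_Cons:
  assumes "p < length (concat (u # us))"
  shows "piece_index (u # us) p =
    (if p < length u then 0 else Suc (piece_index us (p - length u)))"
proof (cases "p < length u")
  case True
  then show ?thesis by (auto intro!: piece_index_eqI)
next
  case False
  then have "p - length u < length (concat us)" using assms by auto
  from piece_index_exists[OF this] obtain k where k: "k < length us"
     "length (concat (take k us)) \<le> p - length u"
     "p - length u < length (concat (take (Suc k) us))" by blast
  then have "piece_index us (p - length u) = k" by (intro piece_index_eqI) auto
  moreover have "piece_index (u # us) p = Suc k"
    using False k by (intro piece_index_eqI) auto
  ultimately show ?thesis using False by simp
qed

text \<open>
  These are the right end of an induced decomposition, described through the index of its last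
  piece, and serve the case in which the first position lies in the first piece.
\<close>

lemma take_letters_piece_index:
  assumes "q < length (pieces_word ds)"
  defines "l \<equiv> piece_index (map snd ds) q"
  shows "map snd (take_letters (Suc q) ds) = take l (map snd ds) @
      [take (Suc q - length (concat (take l (map snd ds)))) (map snd ds ! l)]"
    and "map fst (take_letters (Suc q) ds) = take (Suc l) (map fst ds)"
  unfolding atomize_conj l_def using assms(1)
proof (induction ds arbitrary: q)
  case (Cons d ds)
  obtain a u where d: "d = (a, u)" by (cases d)
  show ?case
  proof (cases "q < length u")
    case True
    then show ?thesis using Cons.prems by (simp add: d piece_index_Cons)
  next
    case False
    then have q: "q - length u < length (pieces_word ds)" using Cons.prems d by auto
    let ?l = "piece_index (map snd ds) (q - length u)"
    have "Suc q - length (concat (take (Suc ?l) (u # map snd ds)))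
      = Suc (q - length u) - length (concat (take ?l (map snd ds)))"
      and S: "Suc q - length u = Suc (q - length u)"
      using False by simp_all
    moreover have "piece_index (u # map snd ds) q = Suc ?l"
      using Cons.prems False by (simp add: d piece_index_Cons)
    moreover have "take_letters (Suc q) (d # ds) = d # take_letters (Suc (q - length u)) ds"
      using False S by (simp add: d)
    ultimately show ?thesis
      unfolding d list.map snd_conv fst_conv using Cons.IH[OF q]
      by (simp only: list.map snd_conv fst_conv take_Suc_Cons nth_Cons_Suc append_Cons)
  qed
qed simp

text \<open>
  The bridge to the definition of recognisability: induced decompositions are obtained by the two
  cutting operations. The induction on the list of pieces removes a first piece that lies
  entirely before the range, which shifts both piece indices by one.
\<close>

lemma induced_decomposition_take_drop_letters:
  assumes "p \<le> q" "q < length (pieces_word ds)"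
  shows "induced_decomposition (map snd ds, map fst ds) p q =
    (let e = take_letters (Suc q - p) (drop_letters p ds) in (map snd e, map fst e))"
  using assms
proof (induction ds arbitrary: p q)
  case (Cons d ds)
  obtain a u where d: "d = (a, u)" by (cases d)
  have k: "piece_index (u # map snd ds) p =
      (if p < length u then 0 else Suc (piece_index (map snd ds) (p - length u)))"
    and l: "piece_index (u # map snd ds) q =
      (if q < length u then 0 else Suc (piece_index (map snd ds) (q - length u)))"
    using Cons.prems d by (auto simp: piece_index_Cons)
  consider "q < length u" | "p < length u" "length u \<le> q" | "length u \<le> p" by linarith
  then show ?case
  proof cases
    case 1
    then show ?thesis using Cons.prems
      by (auto simp: induced_decomposition_def d k l Let_def)
  next
    case 2
    then have q: "q - length u < length (pieces_word ds)" using Cons.prems d by auto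
    let ?l = "piece_index (map snd ds) (q - length u)"
    have S: "Suc q - p - (length u - p) = Suc (q - length u)" "\<not> Suc q - p \<le> length u - p"
      using 2 by auto
    have S': "Suc q - length (concat (take (Suc ?l) (u # map snd ds)))
      = Suc (q - length u) - length (concat (take ?l (map snd ds)))" using 2 by simp
    have "induced_decomposition (map snd (d # ds), map fst (d # ds)) p q
      = (drop p u # map snd (take_letters (Suc (q - length u)) ds),
         a # map fst (take_letters (Suc (q - length u)) ds))"
      unfolding take_letters_piece_index[OF q] induced_decomposition_def prod.case Let_def d
        list.map fst_conv snd_conv k l
      using 2 S' by simp
    moreover have "take_letters (Suc q - p) (drop_letters p (d # ds))
      = (a, drop p u) # take_letters (Suc (q - length u)) ds"
      using 2 S by (simp add: d del: diff_diff_left)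
    ultimately show ?thesis by simp
  next
    case 3
    have q: "p - length u \<le> q - length u" "q - length u < length (pieces_word ds)"
      using Cons.prems d 3 by auto
    have S: "Suc (q - length u) - (p - length u) = Suc q - p" using 3 Cons.prems by auto
    let ?k = "piece_index (map snd ds) (p - length u)" and ?l = "piece_index (map snd ds) (q - length u)"
    have "Suc q - length (concat (take (Suc ?l) (u # map snd ds)))
      = Suc (q - length u) - length (concat (take ?l (map snd ds)))"
      "p - length (concat (take (Suc ?k) (u # map snd ds)))
      = p - length u - length (concat (take ?k (map snd ds)))"
      "drop p (concat (u # map snd ds)) = drop (p - length u) (concat (map snd ds))"
      "\<not> p < length u" "\<not> q < length u"
      using 3 Cons.prems(1) by simp_all
    then have "induced_decomposition (map snd (d # ds), map fst (d # ds)) p q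
      = induced_decomposition (map snd ds, map fst ds) (p - length u) (q - length u)"
      unfolding induced_decomposition_def prod.case Let_def d list.map fst_conv snd_conv k l S[symmetric]
      by (simp only: if_False nat.inject nth_Cons_Suc drop_Suc_Cons take_Suc_Cons diff_Suc_Suc)
    moreover have "drop_letters p (d # ds) = drop_letters (p - length u) ds" using 3 by (simp add: d)
    ultimately show ?thesis unfolding Cons.IH[OF q] S by (simp only:)
  qed
qed simp

section \<open>Inflation word decompositions as tilings\<close>

text \<open>
  The four combinations of the flags are the four roles of a piece in an inflation word
  decomposition: only piece (both), first (left only), last (right only), interior (neither).
  A single condition quantified over all splittings of the list then covers all pieces.
\<close>

definition fragment :: "('a \<Rightarrow> 'a list set) \<Rightarrow> bool \<Rightarrow> bool \<Rightarrow> 'a \<Rightarrow> 'a list \<Rightarrow> bool" where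
  "fragment \<theta> cutl cutr a u \<longleftrightarrow>
     (\<exists>s t. s @ u @ t \<in> \<theta> a \<and> (cutl \<or> s = []) \<and> (cutr \<or> t = []))"

definition inflation_tiling :: "('a \<Rightarrow> 'a list set) \<Rightarrow> ('a \<times> 'a list) list \<Rightarrow> bool" where
  "inflation_tiling \<theta> ds \<longleftrightarrow> legal \<theta> (map fst ds) \<and> (\<forall>(a, u) \<in> set ds. u \<noteq> []) \<and>
     (\<forall>xs a u ys. ds = xs @ (a, u) # ys \<longrightarrow> fragment \<theta> (xs = []) (ys = []) a u)"

lemma fragment_drop: "fragment \<theta> cutl cutr a u \<Longrightarrow> fragment \<theta> True cutr a (drop m u)"
proof -
  assume "fragment \<theta> cutl cutr a u"
  then obtain s t where "s @ u @ t \<in> \<theta> a" "cutr \<or> t = []" unfolding fragment_def by blast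
  then have "(s @ take m u) @ drop m u @ t \<in> \<theta> a"
    by (metis append.assoc append_take_drop_id)
  with \<open>cutr \<or> t = []\<close> show ?thesis unfolding fragment_def by blast
qed

lemma fragment_take: "fragment \<theta> cutl cutr a u \<Longrightarrow> fragment \<theta> cutl True a (take m u)"
proof -
  assume "fragment \<theta> cutl cutr a u"
  then obtain s t where "s @ u @ t \<in> \<theta> a" "cutl \<or> s = []" unfolding fragment_def by blast
  then have "s @ take m u @ (drop m u @ t) \<in> \<theta> a" by (metis append.assoc append_take_drop_id)
  with \<open>cutl \<or> s = []\<close> show ?thesis unfolding fragment_def by blast
qed

lemma legal_sublist: "legal \<theta> w \<Longrightarrow> sublist v w \<Longrightarrow> v \<noteq> [] \<Longrightarrow> legal \<theta> v"
  unfolding legal_def by (meson sublist_order.order_trans)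

text \<open>
  Cutting turns the piece at the cut into an end piece and keeps the role of the later ones, while
  the remaining labels form a factor of a legal word. The next lemma is the mirror image.
\<close>

lemma inflation_tiling_drop_letters:
  assumes "inflation_tiling \<theta> ds" "n < length (pieces_word ds)"
  shows "inflation_tiling \<theta> (drop_letters n ds)"
proof -
  obtain ds1 a u ds2 m where *: "ds = ds1 @ (a, u) # ds2" "m < length u"
      "drop_letters n ds = (a, drop m u) # ds2"
    using drop_letters_split[OF assms(2)] by metis
  have "legal \<theta> (map fst (drop_letters n ds))"
  proof (rule legal_sublist)
    show "legal \<theta> (map fst ds)" using assms(1) by (simp add: inflation_tiling_def)
    show "sublist (map fst (drop_letters n ds)) (map fst ds)"
      unfolding *(3) by (intro suffix_imp_sublist) (simp add: *(1) suffix_def)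
  qed (simp add: *(3))
  moreover have "\<forall>(a, u) \<in> set (drop_letters n ds). u \<noteq> []"
    using assms(1) * by (auto simp: inflation_tiling_def)
  moreover have "fragment \<theta> (xs = []) (ys = []) b w"
    if "drop_letters n ds = xs @ (b, w) # ys" for xs b w ys
  proof (cases xs)
    case Nil
    then have "b = a" "w = drop m u" "ys = ds2" using that * by auto
    moreover have "fragment \<theta> (ds1 = []) (ds2 = []) a u"
      using assms(1) *(1) unfolding inflation_tiling_def by blast
    ultimately show ?thesis using fragment_drop Nil by auto
  next
    case (Cons c xs')
    then have "ds = (ds1 @ (a, u) # xs') @ (b, w) # ys" using that * by auto
    then have "fragment \<theta> (ds1 @ (a, u) # xs' = []) (ys = []) b w"
      using assms(1) unfolding inflation_tiling_def by blast
    then show ?thesis using Cons by simp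
  qed
  ultimately show ?thesis unfolding inflation_tiling_def by blast
qed

lemma inflation_tiling_take_letters:
  assumes "inflation_tiling \<theta> ds" "0 < n" "n \<le> length (pieces_word ds)"
  shows "inflation_tiling \<theta> (take_letters n ds)"
proof -
  obtain ds1 a u ds2 m where *: "ds = ds1 @ (a, u) # ds2" "0 < m" "m \<le> length u"
      "take_letters n ds = ds1 @ [(a, take m u)]"
    using take_letters_split[OF assms(2,3)] by metis
  have "legal \<theta> (map fst (take_letters n ds))"
  proof (rule legal_sublist)
    show "legal \<theta> (map fst ds)" using assms(1) by (simp add: inflation_tiling_def)
    show "sublist (map fst (take_letters n ds)) (map fst ds)"
      unfolding *(4) by (intro prefix_imp_sublist) (simp add: *(1) prefix_def)
  qed (simp add: *(4))
  moreover have "\<forall>(a, u) \<in> set (take_letters n ds). u \<noteq> []"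
    using assms(1) * by (auto simp: inflation_tiling_def)
  moreover have "fragment \<theta> (xs = []) (ys = []) b w"
    if "take_letters n ds = xs @ (b, w) # ys" for xs b w ys
  proof (cases ys rule: rev_cases)
    case Nil
    then have "b = a" "w = take m u" "xs = ds1" using that * by auto
    moreover have "fragment \<theta> (ds1 = []) (ds2 = []) a u"
      using assms(1) *(1) unfolding inflation_tiling_def by blast
    ultimately show ?thesis using fragment_take Nil by auto
  next
    case (snoc ys' c)
    then have "ds1 = xs @ (b, w) # ys'" using that * by auto
    then have "ds = xs @ (b, w) # (ys' @ (a, u) # ds2)" using * by auto
    then have "fragment \<theta> (xs = []) (ys' @ (a, u) # ds2 = []) b w"
      using assms(1) unfolding inflation_tiling_def by blast
    then show ?thesis using snoc by simp
  qed
  ultimately show ?thesis unfolding inflation_tiling_def by blast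
qed

lemma inflation_tiling_imp_decomposition:
  assumes "inflation_tiling \<theta> ds"
  shows "inflation_word_decomposition \<theta> (pieces_word ds) (map snd ds, map fst ds)"
proof -
  have leg: "legal \<theta> (map fst ds)" and ne: "\<forall>(a, u) \<in> set ds. u \<noteq> []"
    and frag: "\<And>xs a u ys. ds = xs @ (a, u) # ys \<Longrightarrow> fragment \<theta> (xs = []) (ys = []) a u"
    using assms unfolding inflation_tiling_def by blast+
  have ds: "ds \<noteq> []" using leg by (auto simp: legal_def)
  have nth: "fragment \<theta> (i = 0) (Suc i = length ds) (fst (ds ! i)) (snd (ds ! i))"
    if "i < length ds" for i
    using frag[of "take i ds" "fst (ds ! i)" "snd (ds ! i)" "drop (Suc i) ds"] that
      id_take_nth_drop[OF that] ds by (cases "length ds = Suc i") auto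
  show ?thesis
  proof (cases "length ds = 1")
    case True
    then show ?thesis using nth[of 0] leg ne ds
      by (auto simp: inflation_word_decomposition_def fragment_def hd_map hd_conv_nth
          sublist_def)
  next
    case False
    then have 1: "0 < length ds" "length ds - 1 < length ds" "Suc (length ds - 1) = length ds"
      "length ds - 1 \<noteq> 0" using ds by (auto simp: Suc_lessI neq_Nil_conv)
    have "\<exists>w\<in>\<theta> (hd (map fst ds)). suffix (hd (map snd ds)) w"
      using nth[OF 1(1)] ds False by (auto simp: fragment_def hd_map hd_conv_nth suffix_def)
    moreover have "\<exists>w\<in>\<theta> (last (map fst ds)). prefix (last (map snd ds)) w"
      using nth[OF 1(2)] ds 1 False
      by (auto simp: fragment_def last_map last_conv_nth prefix_def)
    moreover have "map snd ds ! i \<in> \<theta> (map fst ds ! i)" if "0 < i" "i < length ds - 1" for i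
    proof -
      have i: "i < length ds" "(i = 0) = False" "(Suc i = length ds) = False" using that by auto
      show ?thesis using nth[OF i(1)] unfolding i(2,3) by (simp add: fragment_def i(1))
    qed
    ultimately show ?thesis using leg ne False
      by (auto simp: inflation_word_decomposition_def)
  qed
qed

lemma inflation_tiling_zip:
  assumes "legal \<theta> v" "list_all2 (\<lambda>w a. w \<in> \<theta> a) ws v" "\<And>a. [] \<notin> \<theta> a"
  shows "inflation_tiling \<theta> (zip v ws)"
proof -
  have len: "length ws = length v" using assms(2) by (rule list_all2_lengthD)
  have mem: "u \<in> \<theta> a" if "(a, u) \<in> set (zip v ws)" for a u
    using that assms(2) by (auto simp: list_all2_conv_all_nth set_zip)
  have "fragment \<theta> (xs = []) (ys = []) a u" if "zip v ws = xs @ (a, u) # ys" for xs a u ys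
    unfolding fragment_def using mem[of a u] that by (intro exI[of _ "[]"]) auto
  moreover have "\<forall>(a, u) \<in> set (zip v ws). u \<noteq> []" using mem assms(3) by fastforce
  ultimately show ?thesis using assms(1) len unfolding inflation_tiling_def by simp
qed

text \<open>
  Recognisability compares decompositions of the same word. Here it is transferred to occurrences
  of \<open>u\<close>, with context, in two possibly different words: restricting the two tilings to
  the context gives decompositions of one word, and restricting further to \<open>u\<close> is the same as
  restricting the original tilings directly.
\<close>

lemma recognisable_tilings_agree:
  assumes rec: "recognisable_at \<theta> u N" and u: "u \<noteq> []" and len: "length l = N" "length r = N"
    and leg: "legal \<theta> (l @ u @ r)"
    and ds: "inflation_tiling \<theta> ds" "pieces_word ds = x @ l @ u @ r @ y"
    and es: "inflation_tiling \<theta> es" "pieces_word es = x' @ l @ u @ r @ y'"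
  shows "take_letters (length u) (drop_letters (length x + N) ds) =
    take_letters (length u) (drop_letters (length x' + N) es)"
proof -
  let ?n = "length (l @ u @ r)"
  let ?cut = "\<lambda>(x :: 'a list) (ds :: ('a \<times> 'a list) list). take_letters ?n (drop_letters (length x) ds)"
  have tiling: "inflation_tiling \<theta> (?cut x ds)" and word: "pieces_word (?cut x ds) = l @ u @ r"
    if "inflation_tiling \<theta> ds" "pieces_word ds = x @ l @ u @ r @ y"
    for x y :: "'a list" and ds :: "('a \<times> 'a list) list"
  proof -
    have "inflation_tiling \<theta> (drop_letters (length x) ds)"
      using that u by (intro inflation_tiling_drop_letters) auto
    then show "inflation_tiling \<theta> (?cut x ds)"
      using that u by (intro inflation_tiling_take_letters) (auto simp: pieces_word_drop_letters)
    show "pieces_word (?cut x ds) = l @ u @ r"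
      using that by (simp add: pieces_word_drop_letters pieces_word_take_letters)
  qed
  have inner: "take_letters (length u) (drop_letters N (?cut x ds))
      = take_letters (length u) (drop_letters (length x + N) ds)"
    for x :: "'a list" and ds :: "('a \<times> 'a list) list"
    using len u by (simp add: drop_letters_take_letters drop_letters_drop_letters
        take_letters_take_letters)
  have induced: "induced_decomposition (map snd (?cut x ds), map fst (?cut x ds)) N (N + length u - 1)
      = (let e = take_letters (length u) (drop_letters (length x + N) ds) in (map snd e, map fst e))"
    if "inflation_tiling \<theta> ds" "pieces_word ds = x @ l @ u @ r @ y"
    for x y :: "'a list" and ds :: "('a \<times> 'a list) list"
  proof -
    have bounds: "N \<le> N + length u - 1" "N + length u - 1 < length (pieces_word (?cut x ds))"
      unfolding word[OF that] using u len by (auto simp: Suc_le_eq neq_Nil_conv)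
    have "Suc (N + length u - 1) - N = length u" using u by (cases u) auto
    then show ?thesis
      unfolding induced_decomposition_take_drop_letters[OF bounds] by (simp only: inner)
  qed
  have "induced_decomposition (map snd (?cut x ds), map fst (?cut x ds)) N (N + length u - 1)
      = induced_decomposition (map snd (?cut x' es), map fst (?cut x' es)) N (N + length u - 1)"
    using rec leg len inflation_tiling_imp_decomposition[OF tiling[OF ds]]
      inflation_tiling_imp_decomposition[OF tiling[OF es]]
    unfolding recognisable_at_def word[OF ds] word[OF es] by blast
  then show ?thesis
    unfolding induced[OF ds] induced[OF es] Let_def prod.inject
    by (elim conjE) (rule pair_list_eqI)
qed

section \<open>Desubstituting legal words\<close>

lemma list_all2_subst_length:
  assumes "random_substitution \<theta>" "list_all2 (\<lambda>w a. w \<in> \<theta> a) ws v"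
  shows "length v \<le> length (concat ws)"
  using assms(2)
proof induction
  case (Cons w ws a v)
  then have "w \<noteq> []" using assms(1) by (auto simp: random_substitution_def)
  then show ?case using Cons by (cases w) auto
qed simp

lemma subst_power_Suc: "subst_power \<theta> (Suc k) a = subst_set \<theta> (subst_power \<theta> k a)"
  by (simp add: subst_power_def)

text \<open>
  A letter that occurs in no inflation word has a zero row in the substitution matrix, and this
  row remains zero in all positive powers.
\<close>

lemma primitive_imp_letter_legal:
  fixes \<theta> :: "'a::finite \<Rightarrow> 'a list set"
  assumes "random_substitution \<theta>" "compatible \<theta>" "primitive \<theta>"
  shows "legal \<theta> [b]"
proof -
  obtain k where k: "k \<ge> 1" "\<And>i j. matrix_power (subst_matrix \<theta>) k $ i $ j > 0"
    using assms(3) unfolding primitive_def by blast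
  have "\<exists>j. subst_matrix \<theta> $ b $ j \<noteq> 0"
  proof (rule ccontr)
    assume "\<nexists>j. subst_matrix \<theta> $ b $ j \<noteq> 0"
    moreover obtain k' where "k = Suc k'" using k(1) by (cases k) auto
    ultimately have "matrix_power (subst_matrix \<theta>) k $ b $ b = 0"
      by (simp add: matrix_power_def matrix_matrix_mult_def)
    then show False using k(2)[of b b] by simp
  qed
  then obtain j where j: "subst_matrix \<theta> $ b $ j \<noteq> 0" by blast
  obtain w where w: "w \<in> \<theta> j" using assms(1) unfolding random_substitution_def by blast
  then have "b \<in> set w" using j subst_matrix_nth[OF assms(2) w, of b] by (metis count_notin)
  then have "sublist [b] w" by (metis append_Cons append_Nil in_set_conv_decomp sublist_appendI)
  moreover have "w \<in> subst_power \<theta> 1 j"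
    using w by (auto simp: subst_power_def subst_set_def subst_word_def list_all2_Cons2
        intro!: exI[of _ "[w]"])
  ultimately show ?thesis unfolding legal_def by blast
qed

text \<open>
  A legal word is a factor of the image of some word, and the restriction of the tiling of that
  image is a tiling of the legal word. At the first level the preimage is a single letter, and it is
  here that letters must be legal.
\<close>

lemma legal_imp_tiling:
  fixes \<theta> :: "'a::finite \<Rightarrow> 'a list set"
  assumes "random_substitution \<theta>" "compatible \<theta>" "primitive \<theta>" "legal \<theta> w"
  obtains ds where "inflation_tiling \<theta> ds" "pieces_word ds = w"
proof -
  from assms(4) obtain k a W where W: "k \<ge> 1" "W \<in> subst_power \<theta> k a" "sublist w W" "w \<noteq> []"
    unfolding legal_def by blast
  then obtain k' where k': "k = Suc k'" by (cases k) auto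
  obtain v ws where v: "v \<in> subst_power \<theta> k' a" "W = concat ws"
      "list_all2 (\<lambda>w a. w \<in> \<theta> a) ws v"
    using W(2) unfolding k' subst_power_Suc subst_set_def subst_word_def by blast
  have ne: "v \<noteq> []" using v W by auto
  have "legal \<theta> v"
  proof (cases "k' = 0")
    case True
    then have "v = [a]" using v(1) by (simp add: subst_power_def)
    then show ?thesis using primitive_imp_letter_legal[OF assms(1-3)] by simp
  next
    case False
    then show ?thesis using v(1) ne unfolding legal_def by (meson less_one not_le sublist_order.order.refl)
  qed
  then have tiling: "inflation_tiling \<theta> (zip v ws)"
    using v(3) assms(1) by (intro inflation_tiling_zip) (auto simp: random_substitution_def)
  have word: "pieces_word (zip v ws) = W" using v by (simp add: list_all2_lengthD)
  obtain x y where xy: "W = x @ w @ y" using W(3) by (auto simp: sublist_def)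
  let ?ds = "take_letters (length w) (drop_letters (length x) (zip v ws))"
  have "inflation_tiling \<theta> ?ds"
    using W(4) word xy
    by (intro inflation_tiling_take_letters inflation_tiling_drop_letters tiling)
      (simp_all add: pieces_word_drop_letters)
  moreover have "pieces_word ?ds = w"
    using word xy by (simp add: pieces_word_drop_letters pieces_word_take_letters)
  ultimately show thesis by (rule that)
qed

lemma legal_subst_word:
  assumes "random_substitution \<theta>" "legal \<theta> v" "u \<in> subst_word \<theta> v"
  shows "legal \<theta> u"
proof -
  obtain k a W where W: "k \<ge> 1" "W \<in> subst_power \<theta> k a" "sublist v W" "v \<noteq> []"
    using assms(2) unfolding legal_def by blast
  obtain x y where xy: "W = x @ v @ y" using W(3) by (auto simp: sublist_def)
  define c where "c a = (SOME w. w \<in> \<theta> a)" for a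
  have c: "c a \<in> \<theta> a" for a using assms(1) unfolding c_def random_substitution_def by (simp add: some_in_eq)
  obtain ws where ws: "u = concat ws" "list_all2 (\<lambda>w a. w \<in> \<theta> a) ws v"
    using assms(3) unfolding subst_word_def by blast
  have "list_all2 (\<lambda>w a. w \<in> \<theta> a) (map c x @ ws @ map c y) W"
    unfolding xy using ws(2) c by (intro list_all2_appendI) (auto simp: list_all2_conv_all_nth)
  then have "concat (map c x @ ws @ map c y) \<in> subst_power \<theta> (Suc k) a"
    using W(2) unfolding subst_power_Suc subst_set_def subst_word_def by blast
  moreover have "sublist u (concat (map c x @ ws @ map c y))" by (simp add: ws(1) sublist_appendI)
  moreover have "u \<noteq> []" using list_all2_subst_length[OF assms(1) ws(2)] ws(1) W(4)
    by (metis le_zero_eq length_0_conv)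
  ultimately show ?thesis unfolding legal_def by (intro conjI exI[of _ "Suc k"]) auto
qed

section \<open>Images of bi-infinite sequences\<close>

abbreviation image_word :: "('a \<Rightarrow> 'a list) \<Rightarrow> 'a list \<Rightarrow> 'a list" where
  "image_word f w \<equiv> concat (map f w)"

lemma language_sublist:
  assumes "u \<in> language X" "sublist v u" "v \<noteq> []"
  shows "v \<in> language X"
proof -
  obtain x i j where u: "u = map x [i..j]" "x \<in> X" using assms(1) unfolding language_def by blast
  obtain a b where ab: "u = a @ v @ b" using assms(2) by (auto simp: sublist_def)
  let ?i = "i + int (length a)" and ?j = "i + int (length a + length v) - 1"
  have "v = take (length v) (drop (length a) u)" using ab by simp
  also have "\<dots> = map x [?i..?j]"
  proof (rule nth_equalityI)
    have "length u = nat (j - i + 1)" using u by simp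
    then show "length (take (length v) (drop (length a) u)) = length (map x [?i..?j])"
      using ab by simp
    fix n assume "n < length (take (length v) (drop (length a) u))"
    then have "n < length v" by simp
    moreover from this have "length a + n < nat (j - i + 1)" using u(1) ab
      by (metis add_strict_left_mono length_append length_map length_upto trans_less_add1 add.assoc)
    ultimately show "take (length v) (drop (length a) u) ! n = map x [?i..?j] ! n"
      using u(1) by (simp add: nth_upto add.assoc)
  qed
  finally have "v = map x [?i..?j]" .
  moreover have "?i \<le> ?j" using assms(3) by (cases v) auto
  ultimately show ?thesis using u(2) unfolding language_def by blast
qed

lemma language_RS_subshift_legal: "u \<in> language (RS_subshift \<theta>) \<Longrightarrow> legal \<theta> u"
  unfolding language_def RS_subshift_def by auto

lemma sublist_map_upto:
  fixes a b i j :: int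
  assumes "a \<le> i" "i \<le> j" "j \<le> b"
  shows "sublist (map x [i..j]) (map x [a..b])"
proof -
  have "[a..b] = [a..i - 1] @ [i..j] @ [j + 1..b]"
    using assms upto_split1[of a i b] upto_split2[of i j b] by auto
  then show ?thesis by (auto simp: sublist_def)
qed

lemma list_all2_map_choice: "(\<And>a. f a \<in> \<theta> a) \<Longrightarrow> list_all2 (\<lambda>w a. w \<in> \<theta> a) (map f v) v"
  by (simp add: list_all2_conv_all_nth)

lemma image_word_in_subst_word: "(\<And>a. f a \<in> \<theta> a) \<Longrightarrow> image_word f v \<in> subst_word \<theta> v"
  unfolding subst_word_def using list_all2_map_choice by blast

lemma length_image_word_ge:
  assumes "random_substitution \<theta>" "\<And>a. f a \<in> \<theta> a"
  shows "length v \<le> length (image_word f v)"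
  using assms by (intro list_all2_subst_length[OF assms(1)] list_all2_map_choice)

text \<open>
  The image of a bi-infinite sequence under \<open>f\<close>, with the image of position \<open>i\<close> starting at
  position 0. The images \<open>L n\<close> and \<open>R m\<close> of the windows to the left and to the right of \<open>i\<close> extend
  each other and have at least \<open>n\<close> and \<open>m\<close> letters, so they determine all values consistently.
  Each window of the image is a factor of the image of a legal word.
\<close>

lemma image_of_subshift_point:
  fixes i :: int
  assumes rs: "random_substitution \<theta>" and f: "\<And>a. f a \<in> \<theta> a" and x: "x \<in> RS_subshift \<theta>"
  defines "L \<equiv> \<lambda>n. image_word f (map x [i - int n..i - 1])"
    and "R \<equiv> \<lambda>n. image_word f (map x [i..i + int n - 1])"
  obtains y where "y \<in> RS_subshift \<theta>"
    "\<And>n m. map y [- int (length (L n))..int (length (R m)) - 1] = L n @ R m"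
proof -
  (* The window of size nat z + 1 is the first one guaranteed to reach position z. *)
  define y where "y z = (if z \<ge> 0 then R (nat z + 1) ! nat z
    else L (nat (- z)) ! (length (L (nat (- z))) - nat (- z)))" for z
  have lenL: "n \<le> length (L n)" for n
    unfolding L_def using length_image_word_ge[OF rs f, where v = "map x [i - int n..i - 1]"] by simp
  have lenR: "n \<le> length (R n)" for n
    unfolding R_def using length_image_word_ge[OF rs f, where v = "map x [i..i + int n - 1]"] by simp
  have R_extends: "\<exists>t. R m' = R m @ t" if "m \<le> m'" for m m'
  proof -
    have "[i..i + int m' - 1] = [i..i + int m - 1] @ [i + int m..i + int m' - 1]"
    proof (cases "m = m'")
      case False
      then show ?thesis using that by (intro upto_split1) auto
    qed simp
    then show ?thesis unfolding R_def by simp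
  qed
  have L_extends: "\<exists>s. L n' = s @ L n" if "n \<le> n'" for n n'
  proof -
    have "[i - int n'..i - 1] = [i - int n'..i - int n - 1] @ [i - int n..i - 1]"
    proof (cases "n = 0")
      case False
      then show ?thesis using that by (intro upto_split1) auto
    qed simp
    then show ?thesis unfolding L_def by simp
  qed
  have R_nth: "R m ! e = R m' ! e" if "e < length (R m)" "e < length (R m')" for m m' e
  proof (cases "m \<le> m'")
    case True
    then obtain t where "R m' = R m @ t" using R_extends by blast
    then show ?thesis using that(1) by (simp only: nth_append_left)
  next
    case False
    then obtain t where "R m = R m' @ t" using R_extends[of m' m] by auto
    then show ?thesis using that(2) by (simp only: nth_append_left)
  qed
  have L_nth: "L n ! (length (L n) - k) = L n' ! (length (L n') - k)"
    if "0 < k" "k \<le> length (L n)" "k \<le> length (L n')" for n n' k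
  proof -
    have "(s @ w) ! (length (s @ w) - k) = w ! (length w - k)" if "0 < k" "k \<le> length w" for s w :: "'a list"
    proof -
      have "length (s @ w) - k = length s + (length w - k)" using that by simp
      then show ?thesis by (simp only: nth_append_length_plus)
    qed
    then show ?thesis using that L_extends[of n n'] L_extends[of n' n] by (metis nat_le_linear)
  qed
  have window: "map y [- int (length (L n))..int (length (R m)) - 1] = L n @ R m" for n m
  proof (rule nth_equalityI)
    fix t assume "t < length (map y [- int (length (L n))..int (length (R m)) - 1])"
    then have t: "t < length (L n) + length (R m)" by simp
    then have *: "map y [- int (length (L n))..int (length (R m)) - 1] ! t
        = y (int t - int (length (L n)))" by (simp add: nth_upto)
    show "map y [- int (length (L n))..int (length (R m)) - 1] ! t = (L n @ R m) ! t"
    proof (cases "t < length (L n)")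
      case True
      define k where "k = length (L n) - t"
      have k: "0 < k" "k \<le> length (L n)" "t = length (L n) - k" using True by (auto simp: k_def)
      then have "y (int t - int (length (L n))) = L k ! (length (L k) - k)"
        by (simp add: y_def of_nat_diff)
      also have "\<dots> = L n ! t" using L_nth[of k k n] k lenL by simp
      finally show ?thesis using * True by (simp add: nth_append)
    next
      case False
      define e where "e = t - length (L n)"
      have e: "t = length (L n) + e" "e < length (R m)" using False t by (auto simp: e_def)
      then have "y (int t - int (length (L n))) = R (e + 1) ! e" by (simp add: y_def)
      also have "\<dots> = R m ! e" using R_nth[of e "e + 1" m] e lenR[of "e + 1"] by simp
      finally show ?thesis using * e by (simp add: nth_append)
    qed
  qed simp
  have "legal \<theta> (map y [a..b])" if "a \<le> b" for a b
  proof -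
    define n where "n = nat \<bar>a\<bar>"
    define m where "m = nat \<bar>b\<bar> + 1"
    have "- int n \<le> a" "b < int m" by (simp_all add: n_def m_def)
    then have "- int (length (L n)) \<le> a" "b \<le> int (length (R m)) - 1"
      using lenL[of n] lenR[of m] by linarith+
    then have sub: "sublist (map y [a..b]) (L n @ R m)"
      unfolding window[of n m, symmetric] by (intro sublist_map_upto that)
    have "[i - int n..i + int m - 1] = [i - int n..i - 1] @ [i..i + int m - 1]"
      by (rule upto_split1) (simp_all add: m_def)
    then have "image_word f (map x [i - int n..i + int m - 1]) = L n @ R m"
      unfolding L_def R_def by (simp only: map_append concat_append)
    moreover have "legal \<theta> (map x [i - int n..i + int m - 1])"
      using x unfolding RS_subshift_def by (auto simp: m_def)
    then have "legal \<theta> (image_word f (map x [i - int n..i + int m - 1]))"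
      by (rule legal_subst_word[OF rs _ image_word_in_subst_word[of f \<theta>, OF f]])
    ultimately have "legal \<theta> (L n @ R m)" by (simp only:)
    then show ?thesis using sub by (rule legal_sublist) (use that in simp)
  qed
  then have "y \<in> RS_subshift \<theta>" by (simp add: RS_subshift_def)
  then show thesis by (rule that) (rule window)
qed

text \<open>
  The word \<open>V1 @ U @ V2\<close> is kept together with its image because it provides one explicit
  decomposition in which \<open>image_word f U\<close> is cut exactly into the words \<open>f a\<close>; by recognisability
  all decompositions must then look like it.
\<close>

lemma image_in_language_with_context:
  assumes rs: "random_substitution \<theta>" and f: "\<And>a. f a \<in> \<theta> a"
    and U: "U \<in> language (RS_subshift \<theta>)"
  obtains V1 V2 l r s t where "legal \<theta> (V1 @ U @ V2)" "image_word f V1 = s @ l"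
    "image_word f V2 = r @ t" "length l = N" "length r = N"
    "l @ image_word f U @ r \<in> language (RS_subshift \<theta>)"
proof -
  obtain x i j where x: "U = map x [i..j]" "x \<in> RS_subshift \<theta>" "i \<le> j"
    using U unfolding language_def by blast
  obtain y where y: "y \<in> RS_subshift \<theta>"
    "\<And>n m. map y [- int (length (image_word f (map x [i - int n..i - 1])))..
        int (length (image_word f (map x [i..i + int m - 1]))) - 1]
      = image_word f (map x [i - int n..i - 1]) @ image_word f (map x [i..i + int m - 1])"
    using image_of_subshift_point[OF rs f x(2), of i] by blast
  define V1 where "V1 = map x [i - int N..i - 1]"
  define V2 where "V2 = map x [j + 1..j + int N]"
  define m where "m = nat (j - i + 1) + N"
  have m: "i + int m - 1 = j + int N" using x(3) by (simp add: m_def)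
  have UV2: "map x [i..j + int N] = U @ V2"
    using x upto_split2[of i j "j + int N"] by (simp add: V2_def)
  then have "map x [i - int N..j + int N] = V1 @ U @ V2"
    using x(3) upto_split1[of "i - int N" i "j + int N"] by (simp add: V1_def)
  moreover have "legal \<theta> (map x [i - int N..j + int N])" using x unfolding RS_subshift_def by auto
  ultimately have legal: "legal \<theta> (V1 @ U @ V2)" by simp
  have len: "N \<le> length (image_word f V1)" "N \<le> length (image_word f V2)"
    using length_image_word_ge[OF rs f, where v = V1] length_image_word_ge[OF rs f, where v = V2]
    by (simp_all add: V1_def V2_def)
  have FU_ne: "image_word f U \<noteq> []"
    using length_image_word_ge[OF rs f, where v = U] language_RS_subshift_legal[OF U]
    unfolding legal_def by (metis le_zero_eq length_0_conv)
  have image_lang: "image_word f (V1 @ U @ V2) \<in> language (RS_subshift \<theta>)"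
  proof -
    let ?a = "- int (length (image_word f V1))" and ?b = "int (length (image_word f (U @ V2))) - 1"
    have "map y [?a..?b] = image_word f (V1 @ U @ V2)"
      using y(2)[of N m] unfolding m UV2 V1_def[symmetric] by simp
    moreover have "?a \<le> ?b" using calculation FU_ne by (cases "?a \<le> ?b") auto
    ultimately show ?thesis using y(1) unfolding language_def mem_Collect_eq by metis
  qed
  define l where "l = drop (length (image_word f V1) - N) (image_word f V1)"
  define r where "r = take N (image_word f V2)"
  have V1_split: "image_word f V1 = take (length (image_word f V1) - N) (image_word f V1) @ l"
    and V2_split: "image_word f V2 = r @ drop N (image_word f V2)"
    unfolding l_def r_def by simp_all
  have "sublist (l @ image_word f U @ r) (image_word f (V1 @ U @ V2))"
    unfolding map_append concat_append by (subst V1_split, subst V2_split) (auto simp: sublist_def)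
  then have "l @ image_word f U @ r \<in> language (RS_subshift \<theta>)"
    using FU_ne by (intro language_sublist[OF image_lang]) auto
  moreover have "length l = N" "length r = N" using len by (simp_all add: l_def r_def)
  ultimately show thesis using that legal V1_split V2_split by blast
qed

section \<open>Iterated lengths and the inductive step\<close>

definition iterated_length :: "('a \<Rightarrow> 'a list) \<Rightarrow> nat \<Rightarrow> 'a list \<Rightarrow> nat" where
  "iterated_length f m w = length ((image_word f ^^ m) w)"

lemma iterated_length_append:
  "iterated_length f m (u @ v) = iterated_length f m u + iterated_length f m v"
proof -
  have "(image_word f ^^ m) (u @ v) = (image_word f ^^ m) u @ (image_word f ^^ m) v"
    by (induction m) auto
  then show ?thesis by (simp add: iterated_length_def)
qed

lemma iterated_length_Suc: "iterated_length f (Suc m) w = iterated_length f m (image_word f w)"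
  unfolding iterated_length_def by (simp only: funpow_Suc_right comp_apply)

text \<open>
  By compatibility the elements of \<open>\<theta> a\<close> are rearrangements of each other, so this
  makes the choice of \<open>f\<close> immaterial for lengths.
\<close>

lemma iterated_length_cong_mset:
  assumes "mset u = mset v"
  shows "iterated_length f m u = iterated_length f m v"
proof -
  have image: "mset (image_word f w) = sum_mset (image_mset (\<lambda>a. mset (f a)) (mset w))" for w
    by (induction w) auto
  have "mset ((image_word f ^^ m) u) = mset ((image_word f ^^ m) v)"
    using assms by (induction m) (auto simp: image)
  then show ?thesis unfolding iterated_length_def by (rule mset_eq_length)
qed

lemma iterated_length_eq_sum:
  "iterated_length f m w = (\<Sum>a\<leftarrow>w. iterated_length f m [a])"
proof (induction w)
  case Nil
  have "(image_word f ^^ m) [] = []" by (induction m) auto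
  then show ?case by (simp add: iterated_length_def)
next
  case (Cons a w)
  then show ?case using iterated_length_append[of f m "[a]" w] by simp
qed

lemma compatible_mset_eq:
  assumes "compatible \<theta>" "u \<in> \<theta> a" "v \<in> \<theta> a"
  shows "mset u = mset v"
  using assms unfolding compatible_def multiset_eq_iff count_mset by blast

lemma iterated_length_tiles:
  assumes "compatible \<theta>" "\<And>a. f a \<in> \<theta> a" "\<forall>(a, u) \<in> set C. u \<in> \<theta> a"
  shows "iterated_length f m (pieces_word C) = iterated_length f (Suc m) (map fst C)"
proof -
  have "mset (pieces_word C) = mset (image_word f (map fst C))"
    using assms(3)
  proof (induction C)
    case (Cons c C)
    obtain a u where c: "c = (a, u)" by (cases c)
    then have "mset u = mset (f a)"
      using Cons.prems by (intro compatible_mset_eq[OF assms(1) _ assms(2)]) simp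
    then show ?case using Cons c by simp
  qed simp
  then show ?thesis unfolding iterated_length_Suc by (rule iterated_length_cong_mset)
qed

lemma prefix_take_letters: "prefix (map fst (take_letters n ds)) (map fst ds)"
  by (induction n ds rule: take_letters.induct) auto

text \<open>
  If the restriction of a tiling to a range starting at \<open>n\<close> begins with the complete inflation word
  \<open>f b\<close>, then \<open>n\<close> is a genuine cut of the tiling: by compatibility the tile of \<open>b\<close> that
  contains position \<open>n\<close> is at most as long as \<open>f b\<close>, so the cut cannot have shortened it, and for the
  same reason this tile is itself complete.
\<close>

lemma tiling_cut:
  assumes "compatible \<theta>" "\<And>a. f a \<in> \<theta> a" "inflation_tiling \<theta> ds" "n < length (pieces_word ds)"
    "U \<noteq> []" "take_letters k (drop_letters n ds) = zip U (map f U)"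
  obtains A b w B where "ds = A @ (b, w) # B" "length (pieces_word A) = n"
    "prefix U (map fst ((b, w) # B))" "w \<in> \<theta> b"
proof -
  obtain A a u B m where *: "ds = A @ (a, u) # B" "n = length (pieces_word A) + m"
    "m < length u" "drop_letters n ds = (a, drop m u) # B"
    using drop_letters_split[OF assms(4)] by metis
  obtain b U' where U: "U = b # U'" using assms(5) by (cases U) auto
  have eq: "take_letters k ((a, drop m u) # B) = (b, f b) # zip U' (map f U')"
    using assms(6) * U by simp
  then have "a = b \<and> (f b = drop m u \<or> f b = take k (drop m u))"
    unfolding take_letters.simps by (metis Pair_inject list.distinct(1) list.inject)
  then have "a = b" and le: "length (f a) \<le> length u - m" by auto
  have "fragment \<theta> (A = []) (B = []) a u" using assms(3) *(1) unfolding inflation_tiling_def by blast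
  then obtain s t where st: "s @ u @ t \<in> \<theta> a" unfolding fragment_def by blast
  have "length (s @ u @ t) = length (f a)"
    using compatible_mset_eq[OF assms(1) st assms(2)] by (rule mset_eq_length)
  with le *(3) have "m = 0" "length s = 0" "length t = 0" unfolding length_append by linarith+
  moreover have "prefix U (map fst ((a, drop m u) # B))"
    using prefix_take_letters[of k "(a, drop m u) # B"] unfolding *(4)[symmetric] assms(6)
    by simp
  ultimately show thesis using * st by (intro that[of A a u B]) simp_all
qed

text \<open>
  The descent by one level. The word \<open>y @ l @ image_word f U @ r\<close> also begins with
  \<open>l @ image_word f U @ r\<close>; by recognisability a tiling of it has cuts at the start of both copies
  of \<open>image_word f U\<close>, and its labels read \<open>U\<close> from both cuts on. The tiles \<open>C\<close> between the cuts
  are complete, and their labels are the required word.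
\<close>

lemma desubstitute_return_word:
  fixes \<theta> :: "'a::finite \<Rightarrow> 'a list set"
  assumes rs: "random_substitution \<theta>" and comp: "compatible \<theta>" and prim: "primitive \<theta>"
    and f: "\<And>a. f a \<in> \<theta> a" and rec: "\<And>u. legal \<theta> u \<Longrightarrow> recognisable \<theta> u"
    and ret: "\<And>U. U \<in> language (RS_subshift \<theta>) \<Longrightarrow>
      \<exists>y. legal \<theta> (y @ U) \<and> prefix U (y @ U) \<and> \<not> g dvd iterated_length f m y"
    and U: "U \<in> language (RS_subshift \<theta>)"
  shows "\<exists>y. legal \<theta> (y @ U) \<and> prefix U (y @ U) \<and> \<not> g dvd iterated_length f (Suc m) y"
proof -
  let ?F = "image_word f"
  have U_ne: "U \<noteq> []" using language_RS_subshift_legal[OF U] by (simp add: legal_def)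
  then have FU_ne: "?F U \<noteq> []"
    using length_image_word_ge[OF rs f, where v = U] by (metis le_zero_eq length_0_conv)
  have "legal \<theta> (?F U)"
    by (intro legal_subst_word[OF rs language_RS_subshift_legal[OF U]] image_word_in_subst_word f)
  then obtain N where N: "recognisable_at \<theta> (?F U) N" using rec unfolding recognisable_def by blast
  obtain V1 V2 l r s t where V: "legal \<theta> (V1 @ U @ V2)" "?F V1 = s @ l" "?F V2 = r @ t"
    and len: "length l = N" "length r = N" and lang: "l @ ?F U @ r \<in> language (RS_subshift \<theta>)"
    by (rule image_in_language_with_context[OF rs f U])
  have leg: "legal \<theta> (l @ ?F U @ r)" using lang by (rule language_RS_subshift_legal)
  let ?es = "\<lambda>v. zip v (map f v)"
  have es: "pieces_word (?es v) = ?F v" "\<forall>(a, u) \<in> set (?es v). u \<noteq> []" for v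
    using rs f by (auto simp: random_substitution_def set_zip) metis
  have es_tiling: "inflation_tiling \<theta> (?es (V1 @ U @ V2))"
    using rs by (intro inflation_tiling_zip[OF V(1)] list_all2_map_choice f)
      (simp add: random_substitution_def)
  have es_word: "pieces_word (?es (V1 @ U @ V2)) = s @ l @ ?F U @ r @ t"
    unfolding es(1) using V(2,3) by simp
  (* The reference tiling, in which every letter a of V1 @ U @ V2 has the tile f a. *)
  have es_cut: "take_letters (length (?F U)) (drop_letters (length s + N) (?es (V1 @ U @ V2))) = ?es U"
  proof -
    have split: "?es (V1 @ U @ V2) = ?es V1 @ ?es (U @ V2)" "?es (U @ V2) = ?es U @ ?es V2" by simp_all
    have "length s + N = length (pieces_word (?es V1))" unfolding es(1) V(2) using len by simp
    then have "drop_letters (length s + N) (?es (V1 @ U @ V2)) = ?es (U @ V2)"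
      unfolding split(1) by (simp only: drop_letters_append[OF es(2)])
    then show ?thesis
      using take_letters_append[OF es(2)[of U], of "?es V2"] unfolding es(1) split(2) by simp
  qed
  obtain y where y: "legal \<theta> (y @ l @ ?F U @ r)" "prefix (l @ ?F U @ r) (y @ l @ ?F U @ r)"
    "\<not> g dvd iterated_length f m y"
    using ret[OF lang] by blast
  obtain z where z: "y @ l @ ?F U @ r = (l @ ?F U @ r) @ z" using y(2) by (auto simp: prefix_def)
  obtain ds where ds: "inflation_tiling \<theta> ds" "pieces_word ds = y @ l @ ?F U @ r"
    using legal_imp_tiling[OF rs comp prim y(1)] by blast
  have cut1: "take_letters (length (?F U)) (drop_letters N ds) = ?es U"
  proof -
    have "pieces_word ds = [] @ l @ ?F U @ r @ z" using ds(2) z by simp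
    then show ?thesis
      using recognisable_tilings_agree[OF N FU_ne len leg ds(1) _ es_tiling es_word] es_cut
      by fastforce
  qed
  have cut2: "take_letters (length (?F U)) (drop_letters (length y + N) ds) = ?es U"
    using recognisable_tilings_agree[OF N FU_ne len leg ds(1) _ es_tiling es_word, of y "[]"] ds(2) es_cut
    by (simp del: map_append)
  obtain A1 b1 w1 B1 where A1: "ds = A1 @ (b1, w1) # B1" "length (pieces_word A1) = N"
    "prefix U (map fst ((b1, w1) # B1))" "w1 \<in> \<theta> b1"
    by (rule tiling_cut[OF comp f ds(1) _ U_ne cut1]) (use ds(2) len FU_ne in auto)
  obtain A2 b2 w2 B2 where A2: "ds = A2 @ (b2, w2) # B2" "length (pieces_word A2) = length y + N"
    "prefix U (map fst ((b2, w2) # B2))" "w2 \<in> \<theta> b2"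
    by (rule tiling_cut[OF comp f ds(1) _ U_ne cut2]) (use ds(2) len FU_ne in auto)
  have word_A1: "pieces_word A1 = l"
  proof -
    have "pieces_word A1 = take N (pieces_word ds)" using A1(1,2) by simp
    then show ?thesis using ds(2) z len by simp
  qed
  have word_A2: "pieces_word A2 = y @ l"
  proof -
    have "pieces_word A2 = take (length y + N) (pieces_word ds)" using A2(1,2) by simp
    then show ?thesis using ds(2) len by simp
  qed
  have ne: "\<forall>(a, u) \<in> set ds. u \<noteq> []" using ds(1) unfolding inflation_tiling_def by blast
  obtain C where C: "A2 = A1 @ C"
  proof -
    have "prefix A1 A2 \<or> prefix A2 A1"
      using prefixI[OF A1(1)] prefixI[OF A2(1)] by (rule prefix_same_cases)
    moreover have "prefix A1 A2" if pre: "prefix A2 A1"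
    proof -
      obtain D where D: "A1 = A2 @ D" using pre unfolding prefix_def by blast
      then have "pieces_word D = []" using A1(2) A2(2) by simp
      moreover have "\<forall>(a, u) \<in> set D. u \<noteq> []" using ne A1(1) D by auto
      ultimately have "D = []" by (cases D) auto
      then show ?thesis using D by simp
    qed
    ultimately have "prefix A1 A2" by blast
    then show thesis using that by (elim prefixE)
  qed
  have tiles: "\<forall>(a, u) \<in> set C. u \<in> \<theta> a"
  proof clarify
    fix a u assume "(a, u) \<in> set C"
    then obtain P Q where PQ: "C = P @ (a, u) # Q" by (meson split_list)
    have dec: "ds = (A1 @ P) @ (a, u) # (Q @ (b2, w2) # B2)"
      using A2(1) unfolding C PQ by simp
    then have "fragment \<theta> (A1 @ P = []) (Q @ (b2, w2) # B2 = []) a u"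
      using ds(1) unfolding inflation_tiling_def by blast
    then have frag: "fragment \<theta> (A1 @ P = []) False a u" by simp
    show "u \<in> \<theta> a"
    proof (cases "P = []")
      case True
      then have "(b1, w1) # B1 = (a, u) # (Q @ (b2, w2) # B2)"
        using dec unfolding A1(1) by simp
      then show ?thesis using A1(4) by simp
    next
      case False
      then show ?thesis using frag by (auto simp: fragment_def)
    qed
  qed
  (* pieces_word C is a conjugate of y rather than y itself, as both cuts are preceded by l. *)
  have "iterated_length f m (pieces_word C) = iterated_length f m y"
  proof -
    have "l @ pieces_word C = y @ l"
      using word_A2 unfolding C map_append concat_append word_A1 .
    then have "iterated_length f m (l @ pieces_word C) = iterated_length f m (y @ l)" by (simp only:)
    then show ?thesis unfolding iterated_length_append by simp
  qed
  then have len_C: "\<not> g dvd iterated_length f (Suc m) (map fst C)"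
    using y(3) iterated_length_tiles[OF comp f tiles] by simp
  obtain t2 where t2: "map fst ((b2, w2) # B2) = U @ t2" using A2(3) by (auto simp: prefix_def)
  have B1: "map fst ((b1, w1) # B1) = (map fst C @ U) @ t2"
  proof -
    have "(b1, w1) # B1 = C @ (b2, w2) # B2" using A2(1) unfolding A1(1) C by (simp only: append_assoc same_append_eq)
    then show ?thesis by (simp only: map_append t2 append_assoc)
  qed
  have "legal \<theta> (map fst ds)" using ds(1) unfolding inflation_tiling_def by blast
  moreover have "map fst ds = map fst A1 @ (map fst C @ U) @ t2"
    unfolding A2(1) C map_append t2 by (simp only: append_assoc)
  ultimately have "legal \<theta> (map fst A1 @ (map fst C @ U) @ t2)" by (simp only:)
  then have "legal \<theta> (map fst C @ U)" by (rule legal_sublist[OF _ sublist_appendI]) (use U_ne in simp)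
  moreover have "prefix U (map fst C @ U)"
    using A1(3) unfolding B1 by (rule prefix_length_prefix) simp_all
  ultimately show ?thesis using len_C by blast
qed

theorem theorem12:
  fixes \<theta> :: "'a::finite \<Rightarrow> 'a list set"
  assumes "random_substitution \<theta>"
    and "compatible \<theta>"
    and "primitive \<theta>"
    and "locally_recognisable \<theta>"
    and "topologically_mixing (RS_subshift \<theta>)"
  shows "\<forall>n\<ge>1. Gcd {inflation_length \<theta> n a | a. a \<in> UNIV} = 1"
proof (intro allI impI)
  fix n :: nat assume "n \<ge> 1"
  define g where "g = Gcd {inflation_length \<theta> n a | a. a \<in> UNIV}"
  define f where "f a = (SOME w. w \<in> \<theta> a)" for a
  have f: "f a \<in> \<theta> a" for a
    using assms(1) unfolding f_def random_substitution_def by (simp add: some_in_eq)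
  have g_dvd: "g dvd iterated_length f n [a]" for a
  proof -
    have "(image_word f ^^ n) [a] \<in> subst_power \<theta> n a"
    proof (induction n)
      case (Suc n)
      then show ?case
        using image_word_in_subst_word[of f \<theta>, OF f] by (auto simp: subst_power_Suc subst_set_def)
    qed (simp add: subst_power_def)
    then have "inflation_length \<theta> n a = iterated_length f n [a]"
      unfolding iterated_length_def by (rule inflation_length_eq[OF assms(2)])
    then have "iterated_length f n [a] \<in> {inflation_length \<theta> n a | a. a \<in> UNIV}"
      unfolding mem_Collect_eq by (metis UNIV_I)
    then show ?thesis unfolding g_def by (rule Gcd_dvd)
  qed
  show "Gcd {inflation_length \<theta> n a | a. a \<in> UNIV} = 1"
  proof (rule ccontr)
    assume "Gcd {inflation_length \<theta> n a | a. a \<in> UNIV} \<noteq> 1"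
    then have g: "g \<noteq> 1" by (simp add: g_def)
    have rec: "recognisable \<theta> u" if "legal \<theta> u" for u
      using assms(4) that unfolding locally_recognisable_def by blast
    have return_word: "\<exists>y. legal \<theta> (y @ U) \<and> prefix U (y @ U) \<and> \<not> g dvd iterated_length f m y"
      if "U \<in> language (RS_subshift \<theta>)" for U m
      using that
    proof (induction m arbitrary: U)
      case 0
      obtain N where N: "\<And>k. k \<ge> N \<Longrightarrow> \<exists>w. length w = k \<and> U @ w @ U \<in> language (RS_subshift \<theta>)"
        using assms(5) 0 unfolding topologically_mixing_def by blast
      (* Two consecutive displacements cannot both be multiples of g. *)
      have "\<not> g dvd length U + N \<or> \<not> g dvd length U + Suc N"
        using g by (metis add_Suc_right dvd_add_right_iff nat_dvd_1_iff_1 Suc_eq_plus1)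
      then obtain k where k: "k \<ge> N" "\<not> g dvd length U + k" by (metis le_SucI order_refl)
      obtain w where "length w = k" "U @ w @ U \<in> language (RS_subshift \<theta>)" using N[OF k(1)] by blast
      then show ?case using k(2) language_RS_subshift_legal
        by (intro exI[of _ "U @ w"]) (auto simp: iterated_length_def)
    next
      case (Suc m)
      show ?case
        by (rule desubstitute_return_word[OF assms(1-3) f rec Suc.IH Suc.prems])
    qed
    obtain U where "U \<in> language (RS_subshift \<theta>)"
      using assms(5) unfolding topologically_mixing_def language_def by blast
    then obtain y where "\<not> g dvd iterated_length f n y" using return_word by blast
    moreover have "g dvd iterated_length f n y"
      unfolding iterated_length_eq_sum[of f n y] using g_dvd by (induction y) auto
    ultimately show False by blast
  qed
qed

end
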